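(* Let $w\in S_n$, let $C^G(w)$ be the greedy climbing chain of $w$, and let $\xi(w)=(C^G(w),C^G(w))$ be this chain with all links marked. Then $$\mathrm{wt}(\xi(w))=\mathrm{invcode}(w).$$
   Context: Conventions. Permutations are in one-line notation; $t_{ij}$ is the transposition of $i,j$, and $wt_{ij}$ is $w$ with the values in positions $i$ and $j$ exchanged. $w_0\in S_n$ is the longest permutation, $w_0(k)=n+1-k$. The Bruhat order is the transitive closure of $w\le wt_{ij}$ for $i<j$ with $w(i)<w(j)$; $\lessdot$ denotes its cover relation. $[n]=\{1,\ldots,n\}$. Climbing chains. A climbing chain of $w\in S_n$ is a sequence $C=(C_1,\ldots,C_m)$ of pairs (links) $C_p=(i_p,j_p)$ with $i_p<j_p$, $i_1\le\cdots\le i_m$, $wt_{i_1j_1}\cdots t_{i_mj_m}=w_0$, and $wt_{i_1j_1}\cdots t_{i_{p-1}j_{p-1}}\lessdot wt_{i_1j_1}\cdots t_{i_pj_p}$ for each $p\in[m]$. (The only climbing chain of $w_0$ is empty. The links of a chain are distinct, so $C$ is also regarded as a set.) For a chain $C$ and a set $U\subseteq C$ of marked links, $\mathrm{wt}(C,U)\in\mathbb{Z}^n$ is defined by $\mathrm{wt}(C,U)_k=n-k-\#\{\text{links of the form }(k,\star)\text{ in }U\}$ for $k\in[n]$. Greedy chain. For $w\ne w_0$ set $a=\min\{k\mid w(k)\ne n+1-k\}$, $b=w^{-1}(w(a)+1)$ and $\mathrm{greedy}(w)=(a,b)$. $C^G(w_0)$ is empty; for $w\neq w_0$ with $\mathrm{greedy}(w)=(a,b)$,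 $C^G(w)$ is obtained by prepending $(a,b)$ to $C^G(wt_{ab})$. It is a climbing chain of $w$. $\mathrm{invcode}(w)\in\mathbb{Z}^n$ is the Lehmer code, $\mathrm{invcode}(w)_i=\#\{j>i\mid w(j)<w(i)\}$. *)

theory Defs
  imports "HOL-Combinatorics.Permutations"
begin

text \<open>
  An element of \<open>S\<^sub>n\<close> is a function \<open>w :: nat \<Rightarrow> nat\<close> with \<open>w permutes {1..n}\<close>; in one-line notation
  it is \<open>w 1, \<dots>, w n\<close>. The product \<open>w t\<^sub>i\<^sub>j\<close>, which exchanges the values in positions \<open>i\<close> and \<open>j\<close>,
  is \<open>w \<circ> transpose i j\<close>. A vector in \<open>\<int>\<^sup>n\<close> is a function \<open>nat \<Rightarrow> int\<close> of which only the values
  on \<open>{1..n}\<close> are relevant.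
\<close>

definition longest_perm :: "nat \<Rightarrow> nat \<Rightarrow> nat" where
  "longest_perm n k = (if k \<in> {1..n} then n + 1 - k else k)"

type_synonym link = "nat \<times> nat"
type_synonym marked_chain = "link list \<times> link set"

definition greedy :: "nat \<Rightarrow> (nat \<Rightarrow> nat) \<Rightarrow> link" where
  "greedy n w =
    (let a = Min {k \<in> {1..n}. w k \<noteq> n + 1 - k}
     in (a, inv w (w a + 1)))"

lemma greedy_props:
  assumes w: "w permutes {1..n}" and ne: "w \<noteq> longest_perm n" and ab: "greedy n w = (a, b)"
  shows "a \<in> {1..n}" "b \<in> {1..n}" "a < b" "w b = w a + 1"
proof -
  let ?K = "{k \<in> {1..n}. w k \<noteq> n + 1 - k}"
  have a: "a = Min ?K" and b: "b = inv w (w a + 1)"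
    using ab by (auto simp: greedy_def Let_def)
  have "?K \<noteq> {}"
  proof
    assume "?K = {}"
    then have "w k = longest_perm n k" for k
      using permutes_not_in[OF w, of k] by (auto simp: longest_perm_def)
    with ne show False by auto
  qed
  then have aK: "a \<in> ?K" unfolding a by (intro Min_in) auto
  then show a_in: "a \<in> {1..n}" by simp
  show wb: "w b = w a + 1"
    unfolding b using permutes_inverses(1)[OF w] by simp
  have less: "w k = n + 1 - k" if "k \<in> {1..n}" "k < a" for k
    using that Min_le[of ?K k] unfolding a by fastforce
  have wa: "w a \<in> {1..n}" using a_in permutes_in_image[OF w] by blast
  have wa_le: "w a < n + 1 - a"
  proof (rule ccontr)
    assume "\<not> ?thesis"
    with aK have gt: "w a > n + 1 - a" by auto
    define k where "k = n + 1 - w a"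
    have k: "k \<in> {1..n}" "k < a" "n + 1 - k = w a"
      using wa gt a_in by (auto simp: k_def)
    then have "w k = w a" using less by simp
    then have "k = a" using permutes_inj[OF w] by (auto dest: injD)
    with k show False by simp
  qed
  then have "w b \<in> {1..n}" using wb a_in by auto
  then show b_in: "b \<in> {1..n}" using permutes_in_image[OF w] by blast
  show "a < b"
  proof (rule ccontr)
    assume "\<not> a < b"
    moreover have "a \<noteq> b" using wb by auto
    ultimately have "b < a" by simp
    then have "w b = n + 1 - b" using less b_in by simp
    with \<open>b < a\<close> wa_le wb a_in show False by auto
  qed
qed

text \<open>
  For \<open>w\<close> in \<open>S\<^sub>n\<close> this is the recursive description of \<open>C\<^sup>G(w)\<close>. The value outside \<open>S\<^sub>n\<close> is a dummy.
  The recursion terminates because \<open>\<Sum>k. k * w k\<close> decreases.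
\<close>

function greedy_chain :: "nat \<Rightarrow> (nat \<Rightarrow> nat) \<Rightarrow> link list" where
  "greedy_chain n w =
    (if w permutes {1..n} \<and> w \<noteq> longest_perm n
     then (case greedy n w of (a, b) \<Rightarrow> (a, b) # greedy_chain n (w \<circ> transpose a b))
     else [])"
  by auto

termination
proof (relation "measure (\<lambda>(n, w). \<Sum>k\<in>{1..n}. k * w k)", goal_cases)
  case 1
  then show ?case by simp
next
  case (2 n w a b)
  then have w: "w permutes {1..n}" and ab: "greedy n w = (a, b)" and ne: "w \<noteq> longest_perm n"
    by auto
  note p = greedy_props[OF w ne ab]
  let ?S = "{1..n} - {a} - {b}"
  have split: "(\<Sum>k\<in>{1..n}. k * u k) = a * u a + (b * u b + (\<Sum>k\<in>?S. k * u k))"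
    for u :: "nat \<Rightarrow> nat"
    using p sum.remove[of "{1..n}" a "\<lambda>k. k * u k"]
      sum.remove[of "{1..n} - {a}" b "\<lambda>k. k * u k"] by auto
  have "(\<Sum>k\<in>?S. k * (w \<circ> transpose a b) k) = (\<Sum>k\<in>?S. k * w k)"
    by (intro sum.cong) (auto simp: transpose_def)
  then show ?case
    using p(3,4) by (simp only: in_measure prod.case split[of w] split[of "w \<circ> transpose a b"])
      (simp add: algebra_simps)
qed

declare greedy_chain.simps [simp del]

definition wt :: "nat \<Rightarrow> marked_chain \<Rightarrow> nat \<Rightarrow> int" where
  "wt n = (\<lambda>(C, U) k. int n - int k - int (card {l \<in> U. fst l = k}))"

definition greedy_marked :: "nat \<Rightarrow> (nat \<Rightarrow> nat) \<Rightarrow> marked_chain" where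
  "greedy_marked n w = (greedy_chain n w, set (greedy_chain n w))"

definition invcode :: "nat \<Rightarrow> (nat \<Rightarrow> nat) \<Rightarrow> nat \<Rightarrow> int" where
  "invcode n w i = int (card {j \<in> {1..n}. i < j \<and> w j < w i})"

end

theory Submission
  imports Defs
begin

text \<open>
  A greedy step exchanges the adjacent values \<open>w a\<close> and \<open>w a + 1\<close>, sitting at positions \<open>a < b\<close>. It
  changes the relative order of the values at \<open>a\<close> and \<open>b\<close> only, so it lowers the number of later
  larger values by one at \<open>a\<close> and keeps it at every other position. This number vanishes for
  \<open>w\<^sub>0\<close>, hence the greedy chain has exactly \<open>#{j > k. w j > w k}\<close> links \<open>(k, \<star>)\<close>. The links are
  distinct because a pair of positions that has been inverted stays inverted.
\<close>

definition noninversions :: "nat \<Rightarrow> (nat \<Rightarrow> nat) \<Rightarrow> nat \<Rightarrow> nat set" where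
  "noninversions n w k = {j \<in> {1..n}. k < j \<and> w k < w j}"

lemma finite_noninversions [simp]: "finite (noninversions n w k)"
  by (simp add: noninversions_def)

text \<open>No value lies strictly between \<open>w a\<close> and \<open>w a + 1\<close>, so
  exchanging these two leaves their comparison with any third value unchanged.\<close>

lemma transpose_adjacent_less_iff:
  fixes w :: "'a \<Rightarrow> nat"
  assumes "inj w" "w b = w a + 1" "(k, l) \<noteq> (a, b)" "(k, l) \<noteq> (b, a)"
  shows "(w \<circ> transpose a b) k < (w \<circ> transpose a b) l \<longleftrightarrow> w k < w l"
proof -
  have eq: "w x = w y \<longleftrightarrow> x = y" for x y
    using assms(1) by (simp add: inj_eq)
  show ?thesis
    using assms(2-4) eq[of k a] eq[of k b] eq[of l a] eq[of l b]
    by (auto simp: transpose_def)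
qed

lemma noninversions_transpose_adjacent:
  assumes "inj w" "w b = w a + 1" "a < b"
  shows "noninversions n (w \<circ> transpose a b) k = noninversions n w k - (if k = a then {b} else {})"
proof -
  have "j \<in> noninversions n (w \<circ> transpose a b) k \<longleftrightarrow>
      j \<in> noninversions n w k - (if k = a then {b} else {})" for j
  proof (cases "(k, j) = (a, b) \<or> (k, j) = (b, a)")
    case True
    \<comment> \<open>For \<open>(a, b)\<close> the exchange creates an inversion, so
      \<open>b\<close> leaves the set; \<open>(b, a)\<close> is never counted, since
      \<open>a < b\<close>.\<close>
    then show ?thesis using assms(2,3) by (auto simp: noninversions_def)
  next
    case False
    with transpose_adjacent_less_iff[OF assms(1,2), of k j] show ?thesis
      by (auto simp: noninversions_def)
  qed
  then show ?thesis by blast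
qed

lemma noninversions_longest_perm:
  "k \<in> {1..n} \<Longrightarrow> noninversions n (longest_perm n) k = {}"
  by (auto simp: noninversions_def longest_perm_def)

lemma greedy_chain_longest_perm [simp]: "greedy_chain n (longest_perm n) = []"
  by (simp add: greedy_chain.simps)

lemma greedy_induct [consumes 1, case_names longest step]:
  assumes "w permutes {1..n}"
    and "P (longest_perm n)"
    and "\<And>w a b. w permutes {1..n} \<Longrightarrow> a \<in> {1..n} \<Longrightarrow> b \<in> {1..n} \<Longrightarrow> a < b \<Longrightarrow> w b = w a + 1
      \<Longrightarrow> greedy_chain n w = (a, b) # greedy_chain n (w \<circ> transpose a b)
      \<Longrightarrow> P (w \<circ> transpose a b) \<Longrightarrow> P w"
  shows "P w"
proof -
  \<comment> \<open>\<open>greedy_chain.induct\<close> varies the size argument as well; the premise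
    \<open>m = n\<close> ties it to the fixed \<open>n\<close>.\<close>
  have "m = n \<Longrightarrow> w permutes {1..n} \<Longrightarrow> P w" for m
  proof (induction m w rule: greedy_chain.induct)
    case (1 m w)
    show ?case
    proof (cases "w = longest_perm n")
      case True
      with assms(2) show ?thesis by simp
    next
      case False
      obtain a b where ab: "greedy n w = (a, b)" by fastforce
      note p = greedy_props[OF 1(3) False ab]
      have "w \<circ> transpose a b permutes {1..n}"
        using p by (intro permutes_compose[OF _ 1(3)] permutes_swap_id)
      then have "P (w \<circ> transpose a b)"
        using 1 False ab by metis
      moreover have "greedy_chain n w = (a, b) # greedy_chain n (w \<circ> transpose a b)"
        using 1(3) False ab by (subst greedy_chain.simps) simp
      ultimately show ?thesis
        using assms(3) 1(3) p by blast
    qed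
  qed
  with assms(1) show ?thesis by blast
qed

text \<open>Undoing a greedy step changes the order at the pair \<open>(a, b)\<close> only, so later
  links remain noninversions of \<open>w\<close>. This is what makes the links distinct.\<close>

lemma greedy_chain_noninversion:
  assumes "w permutes {1..n}" "(k, l) \<in> set (greedy_chain n w)"
  shows "k < l" "w k < w l"
proof -
  have "\<forall>(k, l) \<in> set (greedy_chain n w). k < l \<and> w k < w l"
    using assms(1)
  proof (induction rule: greedy_induct)
    case longest
    show ?case by simp
  next
    case (step w a b)
    have "k < l \<and> w k < w l" if "(k, l) \<in> set (greedy_chain n (w \<circ> transpose a b))" for k l
    proof -
      have less: "k < l" "(w \<circ> transpose a b) k < (w \<circ> transpose a b) l"
        using step.IH that by fast+
      \<comment> \<open>After the exchange \<open>(a, b)\<close> is inverted, which excludes the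
        first pair; \<open>k < l\<close> and \<open>a < b\<close> exclude the second.\<close>
      moreover have "(k, l) \<noteq> (a, b)" "(k, l) \<noteq> (b, a)"
        using less step by auto
      ultimately show ?thesis
        using transpose_adjacent_less_iff[OF permutes_inj[OF step.hyps(1)]] step.hyps(5) less(1) by blast
    qed
    with step.hyps show ?case by auto
  qed
  with assms(2) show "k < l" "w k < w l" by auto
qed

lemma card_greedy_chain_links:
  assumes "w permutes {1..n}" "k \<in> {1..n}"
  shows "card {l \<in> set (greedy_chain n w). fst l = k} = card (noninversions n w k)"
  using assms(1)
proof (induction rule: greedy_induct)
  case longest
  show ?case using assms(2) by (simp add: noninversions_longest_perm)
next
  case (step w a b)
  let ?w' = "w \<circ> transpose a b"
  have "?w' permutes {1..n}"
    using step by (intro permutes_compose[OF _ step(1)] permutes_swap_id)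
  \<comment> \<open>Since \<open>?w' a > ?w' b\<close>, this pair cannot be a later link. Hence
    inserting it below raises the cardinality by exactly one.\<close>
  then have notin: "(a, b) \<notin> set (greedy_chain n ?w')"
    using greedy_chain_noninversion(2)[of ?w' n a b] step by auto
  have noninv: "noninversions n ?w' k = noninversions n w k - (if k = a then {b} else {})"
    using step by (intro noninversions_transpose_adjacent permutes_inj)
  show ?case
  proof (cases "k = a")
    case True
    have "b \<in> noninversions n w a"
      using step by (simp add: noninversions_def)
    then have "card (noninversions n w k) = Suc (card (noninversions n ?w' k))"
      using noninv True by (simp only: simp_thms if_True card_Suc_Diff1[OF finite_noninversions])
    moreover have "{l \<in> set (greedy_chain n w). fst l = k}
        = insert (a, b) {l \<in> set (greedy_chain n ?w'). fst l = k}"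
      using step True by auto
    ultimately show ?thesis
      using step.IH notin by (simp del: comp_apply)
  next
    case False
    then have "{l \<in> set (greedy_chain n w). fst l = k} = {l \<in> set (greedy_chain n ?w'). fst l = k}"
      using step by auto
    with False noninv step.IH show ?thesis by (simp del: comp_apply)
  qed
qed

text \<open>The \<open>n - k\<close> positions after \<open>k\<close> split into those with a larger
  and those with a smaller value than \<open>w k\<close>. This turns the link count in
  \<open>wt\<close> into the Lehmer code.\<close>

lemma card_noninversions_add_invcode:
  assumes "w permutes {1..n}" "k \<in> {1..n}"
  shows "int (card (noninversions n w k)) + invcode n w k = int n - int k"
proof -
  let ?I = "{j \<in> {1..n}. k < j \<and> w j < w k}"
  have "w j \<noteq> w k" if "j \<noteq> k" for j
    using permutes_inj[OF assms(1)] that by (simp add: inj_eq)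
  then have "noninversions n w k \<union> ?I = {k<..n}"
    by (force simp: noninversions_def)
  moreover have "card (noninversions n w k \<union> ?I) = card (noninversions n w k) + card ?I"
    by (intro card_Un_disjoint) (auto simp: noninversions_def)
  ultimately have "card (noninversions n w k) + card ?I = n - k"
    by simp
  with assms(2) show ?thesis
    by (simp only: invcode_def of_nat_add[symmetric]) (simp add: of_nat_diff)
qed

theorem theorem5p6:
  fixes n :: nat and w :: "nat \<Rightarrow> nat"
  assumes "w permutes {1..n}"
  shows "\<forall>k\<in>{1..n}. wt n (greedy_marked n w) k = invcode n w k"
  using card_greedy_chain_links[OF assms] card_noninversions_add_invcode[OF assms]
  by (fastforce simp: wt_def greedy_marked_def)

end
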